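(* Let $a_1,a_2,c\in\mathbb{C}$, put $a_s=a_1+a_2$, $a_d=a_1-a_2$, and let $g_1(z)$, $g_2(\bar z)$ be arbitrary holomorphic functions with $g_1g_1'\neq0$, $g_2g_2'\neq0$ (with fixed branches of $\log g_1,\log g_2$). Substitute $$\xi=\log g_1(z)-\log g_2(\bar z),\quad e^u=g_1^{2a_1-1}g_2^{2a_2-1}g_1'g_2'\,\tilde v(\xi),\quad H=g_1^{-a_1}g_2^{-a_2}\,\tilde h(\xi),$$ $$Q=g_1^{a_1-2}g_2^{a_2}g_1'^2\,\tilde q(\xi),\quad R=g_2^{a_2-2}g_1^{a_1}g_2'^2\,\tilde r(\xi)$$ in the Gauss-Codazzi system with constant $c$. This is a reduction to a system of ordinary differential equations in $\xi$ if and only if $a_s c=0$. When $a_sc=0$, the reduced system is (prime $=d/d\xi$) $$(\log\tilde v)''-\tfrac12\left(\tilde h^2-c^2e^{a_d\xi}\right)\tilde v+2\tilde q\tilde r\,\tilde v^{-1}=0,$$ $$2\tilde q'+\tilde v\tilde h'-\tfrac12(a_s+a_d)\tilde v\tilde h-(a_s-a_d)\tilde q=0,$$ $$2\tilde r'+\tilde v\tilde h'+\tfrac12(a_s-a_d)\tilde v\tilde h+(a_s+a_d)\tilde r=0,$$ and it admits the first integral (constant along every solution) $$K=\left(\frac{\tilde v'}{\tilde v}+a_d\right)^2-\left(\tilde h^2-c^2e^{a_d\xi}\right)\tilde v-2\tilde h(\tilde q+\tilde r)-2c\,e^{a_d\xi/2}(\tilde q-\tilde r)-4\frac{\tilde q\tilde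 r}{\tilde v}.$$
   Context: The Gauss-Codazzi system with constant $c$, for complex functions $u,H,Q,R$ (with $R$ standing for $\overline Q$, treated as independent of $Q$) of two independent complex variables $z,\bar z$, is $$u_{z\bar z}+\tfrac12(H^2-c^2)e^u-2QRe^{-u}=0,\qquad Q_{\bar z}-\tfrac12H_ze^u=0,\qquad R_z-\tfrac12H_{\bar z}e^u=0.$$ The substitution is called a reduction to a system of ODEs in $\xi$ if, for each of the three equations, there is a nowhere vanishing function $\lambda(z,\bar z)$, independent of $\tilde v,\tilde h,\tilde q,\tilde r$, such that after the substitution $\lambda$ times the left-hand side is an expression in $\xi$, $\tilde v,\tilde h,\tilde q,\tilde r$ and their $\xi$-derivatives only (with $z,\bar z$ entering only through $\xi$), for arbitrary functions $\tilde v,\tilde h,\tilde q,\tilde r$ of $\xi$. Powers $g_j^a$ mean $e^{a\log g_j}$. The function $\tilde v$ is nowhere vanishing. *)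

theory Defs
  imports "HOL-Complex_Analysis.Complex_Analysis"
begin

text \<open>
  Functions of the two independent variables \<open>z\<close> and \<open>zbar\<close> are curried functions; the second
  variable is written \<open>w\<close>.
\<close>

definition dz :: "(complex \<Rightarrow> complex \<Rightarrow> complex) \<Rightarrow> complex \<Rightarrow> complex \<Rightarrow> complex" where
  "dz f z w = deriv (\<lambda>z'. f z' w) z"

definition dzbar :: "(complex \<Rightarrow> complex \<Rightarrow> complex) \<Rightarrow> complex \<Rightarrow> complex \<Rightarrow> complex" where
  "dzbar f z w = deriv (\<lambda>w'. f z w') w"

type_synonym field2 = "complex \<Rightarrow> complex \<Rightarrow> complex"

type_synonym gc_operator =
  "field2 \<Rightarrow> field2 \<Rightarrow> field2 \<Rightarrow> field2 \<Rightarrow> complex \<Rightarrow> complex \<Rightarrow> complex"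

definition gauss_lhs :: "complex \<Rightarrow> gc_operator" where
  "gauss_lhs c u H Q R z w =
     dzbar (dz u) z w + 1/2 * ((H z w)^2 - c^2) * exp (u z w)
       - 2 * Q z w * R z w * exp (- u z w)"

definition codazzi_Q_lhs :: gc_operator where
  "codazzi_Q_lhs u H Q R z w = dzbar Q z w - 1/2 * dz H z w * exp (u z w)"

definition codazzi_R_lhs :: gc_operator where
  "codazzi_R_lhs u H Q R z w = dz R z w - 1/2 * dzbar H z w * exp (u z w)"

text \<open>
  \<open>l1\<close> and \<open>l2\<close> are the fixed branches of the logarithms of \<open>g1\<close> and \<open>g2\<close>.  Since the substitution
  prescribes only the exponential of \<open>u\<close>, the function \<open>u\<close> is any continuous branch of the logarithm
  of the right-hand side on \<open>N\<close>; such a branch is automatically holomorphic.  It need not exist on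
  the whole domain of \<open>(z, zbar)\<close>, but it exists near every point.
\<close>

definition substitution ::
  "complex \<Rightarrow> complex \<Rightarrow> (complex \<Rightarrow> complex) \<Rightarrow> (complex \<Rightarrow> complex) \<Rightarrow>
   (complex \<Rightarrow> complex) \<Rightarrow> (complex \<Rightarrow> complex) \<Rightarrow> (complex \<times> complex) set \<Rightarrow>
   (complex \<Rightarrow> complex) \<Rightarrow> (complex \<Rightarrow> complex) \<Rightarrow> (complex \<Rightarrow> complex) \<Rightarrow> (complex \<Rightarrow> complex) \<Rightarrow>
   field2 \<Rightarrow> field2 \<Rightarrow> field2 \<Rightarrow> field2 \<Rightarrow> bool" where
  "substitution a1 a2 g1 g2 l1 l2 N v h q r u H Q R \<longleftrightarrow>
     continuous_on N (\<lambda>(z, w). u z w) \<and>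
     (\<forall>(z, w)\<in>N.
        exp (u z w) = exp ((2 * a1 - 1) * l1 z) * exp ((2 * a2 - 1) * l2 w)
                        * deriv g1 z * deriv g2 w * v (l1 z - l2 w) \<and>
        H z w = exp (- a1 * l1 z) * exp (- a2 * l2 w) * h (l1 z - l2 w) \<and>
        Q z w = exp ((a1 - 2) * l1 z) * exp (a2 * l2 w) * (deriv g1 z)^2 * q (l1 z - l2 w) \<and>
        R z w = exp ((a2 - 2) * l2 w) * exp (a1 * l1 z) * (deriv g2 w)^2 * r (l1 z - l2 w))"

text \<open>An operator sending four functions of \<open>\<xi>\<close> to a function of \<open>\<xi>\<close>.\<close>

type_synonym ode_operator =
  "(complex \<Rightarrow> complex) \<Rightarrow> (complex \<Rightarrow> complex) \<Rightarrow> (complex \<Rightarrow> complex) \<Rightarrow> (complex \<Rightarrow> complex) \<Rightarrow>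
   complex \<Rightarrow> complex"

text \<open>
  The substitution turns \<open>L\<close>, up to a nowhere vanishing factor, into \<open>E\<close>.  The factor is chosen once
  for all \<open>v\<close>, \<open>h\<close>, \<open>q\<close>, \<open>r\<close>; these are arbitrary holomorphic functions on the (open) set of values of
  \<open>\<xi>\<close> on an arbitrary open subset \<open>N\<close> of \<open>U \<times> V\<close>.
\<close>

definition equation_reduces_to ::
  "complex set \<Rightarrow> complex set \<Rightarrow> complex \<Rightarrow> complex \<Rightarrow> (complex \<Rightarrow> complex) \<Rightarrow> (complex \<Rightarrow> complex) \<Rightarrow>
   (complex \<Rightarrow> complex) \<Rightarrow> (complex \<Rightarrow> complex) \<Rightarrow> gc_operator \<Rightarrow> ode_operator \<Rightarrow> bool" where
  "equation_reduces_to U V a1 a2 g1 g2 l1 l2 L E \<longleftrightarrow>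
     (\<exists>lam :: field2.
        (\<forall>z\<in>U. \<forall>w\<in>V. lam z w \<noteq> 0) \<and>
        (\<forall>N v h q r u H Q R.
           open N \<longrightarrow> N \<subseteq> U \<times> V \<longrightarrow>
           v holomorphic_on (\<lambda>(z, w). l1 z - l2 w) ` N \<longrightarrow>
           h holomorphic_on (\<lambda>(z, w). l1 z - l2 w) ` N \<longrightarrow>
           q holomorphic_on (\<lambda>(z, w). l1 z - l2 w) ` N \<longrightarrow>
           r holomorphic_on (\<lambda>(z, w). l1 z - l2 w) ` N \<longrightarrow>
           (\<forall>x\<in>(\<lambda>(z, w). l1 z - l2 w) ` N. v x \<noteq> 0) \<longrightarrow>
           substitution a1 a2 g1 g2 l1 l2 N v h q r u H Q R \<longrightarrow>
           (\<forall>(z, w)\<in>N. lam z w * L u H Q R z w = E v h q r (l1 z - l2 w))))"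

definition system_reduces_to ::
  "complex set \<Rightarrow> complex set \<Rightarrow> complex \<Rightarrow> complex \<Rightarrow> complex \<Rightarrow>
   (complex \<Rightarrow> complex) \<Rightarrow> (complex \<Rightarrow> complex) \<Rightarrow> (complex \<Rightarrow> complex) \<Rightarrow> (complex \<Rightarrow> complex) \<Rightarrow>
   ode_operator \<Rightarrow> ode_operator \<Rightarrow> ode_operator \<Rightarrow> bool" where
  "system_reduces_to U V a1 a2 c g1 g2 l1 l2 E1 E2 E3 \<longleftrightarrow>
     equation_reduces_to U V a1 a2 g1 g2 l1 l2 (gauss_lhs c) E1 \<and>
     equation_reduces_to U V a1 a2 g1 g2 l1 l2 codazzi_Q_lhs E2 \<and>
     equation_reduces_to U V a1 a2 g1 g2 l1 l2 codazzi_R_lhs E3"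

definition jet :: "nat \<Rightarrow> (complex \<Rightarrow> complex) \<Rightarrow> complex \<Rightarrow> complex list" where
  "jet n f x = map (\<lambda>k. (deriv ^^ k) f x) [0..<Suc n]"

text \<open>
  An expression in \<open>\<xi>\<close>, the four functions and their derivatives is an arbitrary function \<open>F\<close> of \<open>\<xi>\<close>
  and of the values at \<open>\<xi>\<close> of the derivatives up to some order \<open>n\<close>.
\<close>

definition differential_expression ::
  "nat \<Rightarrow> (complex \<Rightarrow> complex list \<Rightarrow> complex list \<Rightarrow> complex list \<Rightarrow> complex list \<Rightarrow> complex) \<Rightarrow>
   ode_operator" where
  "differential_expression n F v h q r x = F x (jet n v x) (jet n h x) (jet n q x) (jet n r x)"

definition is_reduction ::
  "complex set \<Rightarrow> complex set \<Rightarrow> complex \<Rightarrow> complex \<Rightarrow> complex \<Rightarrow>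
   (complex \<Rightarrow> complex) \<Rightarrow> (complex \<Rightarrow> complex) \<Rightarrow> (complex \<Rightarrow> complex) \<Rightarrow> (complex \<Rightarrow> complex) \<Rightarrow>
   bool" where
  "is_reduction U V a1 a2 c g1 g2 l1 l2 \<longleftrightarrow>
     (\<exists>n F1 F2 F3. system_reduces_to U V a1 a2 c g1 g2 l1 l2
        (differential_expression n F1) (differential_expression n F2)
        (differential_expression n F3))"

text \<open>
  In \<open>reduced1\<close>, \<open>(log v)'\<close> is the logarithmic derivative \<open>v' / v\<close>, which does not depend on a branch
  of \<open>log v\<close>.
\<close>

definition reduced1 :: "complex \<Rightarrow> complex \<Rightarrow> ode_operator" where
  "reduced1 ad c v h q r x =
     deriv (\<lambda>y. deriv v y / v y) x - 1/2 * ((h x)^2 - c^2 * exp (ad * x)) * v x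
       + 2 * q x * r x * inverse (v x)"

definition reduced2 :: "complex \<Rightarrow> complex \<Rightarrow> ode_operator" where
  "reduced2 a_s ad v h q r x =
     2 * deriv q x + v x * deriv h x - 1/2 * (a_s + ad) * v x * h x - (a_s - ad) * q x"

definition reduced3 :: "complex \<Rightarrow> complex \<Rightarrow> ode_operator" where
  "reduced3 a_s ad v h q r x =
     2 * deriv r x + v x * deriv h x + 1/2 * (a_s - ad) * v x * h x + (a_s + ad) * r x"

definition first_integral :: "complex \<Rightarrow> complex \<Rightarrow> ode_operator" where
  "first_integral ad c v h q r x =
     (deriv v x / v x + ad)^2 - ((h x)^2 - c^2 * exp (ad * x)) * v x
       - 2 * h x * (q x + r x) - 2 * c * exp (ad * x / 2) * (q x - r x) - 4 * (q x * r x / v x)"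

definition reduced_solution_on ::
  "complex set \<Rightarrow> complex \<Rightarrow> complex \<Rightarrow> complex \<Rightarrow> (complex \<Rightarrow> complex) \<Rightarrow> (complex \<Rightarrow> complex) \<Rightarrow>
   (complex \<Rightarrow> complex) \<Rightarrow> (complex \<Rightarrow> complex) \<Rightarrow> bool" where
  "reduced_solution_on W a_s ad c v h q r \<longleftrightarrow>
     v holomorphic_on W \<and> h holomorphic_on W \<and> q holomorphic_on W \<and> r holomorphic_on W \<and>
     (\<forall>x\<in>W. v x \<noteq> 0 \<and>
        reduced1 ad c v h q r x = 0 \<and> reduced2 a_s ad v h q r x = 0 \<and>
        reduced3 a_s ad v h q r x = 0)"

end

theory Submission
  imports Defs
begin

text \<open>
  With \<open>X = log g1\<close>, \<open>Y = log g2\<close> as coordinates, the operators become differential expressions in \<open>\<xi>\<close>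
  up to a factor, except that the Gauss equation contains the term
  \<open>c\<^sup>2 exp (2 (a1 X + a2 Y)) v\<close>.  It depends on \<open>\<xi> = X - Y\<close> alone if and only if \<open>c = 0\<close> or
  \<open>a1 + a2 = 0\<close>, since \<open>\<xi>\<close> is invariant under simultaneous translation of \<open>X\<close> and \<open>Y\<close>.  On solutions of
  the reduced system, the derivative of \<open>K\<close> is \<open>- c a_s exp (a_d \<xi> / 2) (q + r + v h)\<close>.
\<close>

section \<open>Continuous logarithms and slices of open sets\<close>

text \<open>By continuity, the imaginary part of \<open>u x - u z\<close> stays within
  \<open>pi\<close> of zero near \<open>z\<close>, so there \<open>u x\<close> equals
  \<open>u z\<close> plus the principal \<open>Ln\<close> of \<open>F x / F z\<close>, a quotient
  near 1 and hence off the branch cut. This yields derivatives of \<open>u\<close>, which the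
  substitution only assumes to be continuous.\<close>

lemma continuous_log_has_field_derivative:
  fixes u F :: "complex \<Rightarrow> complex"
  assumes S: "open S" "z \<in> S" and u: "continuous_on S u"
    and eF: "\<And>x. x \<in> S \<Longrightarrow> exp (u x) = F x"
    and F: "(F has_field_derivative F') (at z)"
  shows "(u has_field_derivative F' / F z) (at z)"
proof -
  have Fz: "F z \<noteq> 0" using eF[OF S(2)] by (metis exp_not_eq_zero)
  have cont: "isCont u z" using S u continuous_on_eq_continuous_at by blast
  then have "((\<lambda>x. Im (u x - u z)) \<longlongrightarrow> Im (u z - u z)) (at z)"
    by (intro tendsto_intros) (simp add: isCont_def)
  then have lim: "((\<lambda>x. Im (u x - u z)) \<longlongrightarrow> 0) (at z)" by simp
  have ev1: "eventually (\<lambda>x. Im (u x - u z) < pi) (at z)"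
    using order_tendstoD(2)[OF lim] pi_gt_zero by blast
  have ev2: "eventually (\<lambda>x. - pi < Im (u x - u z)) (at z)"
    using order_tendstoD(1)[OF lim, of "-pi"] pi_gt_zero by simp
  have ev3: "eventually (\<lambda>x. x \<in> S) (at z)"
    using S by (simp add: eventually_at_in_open')
  have "eventually (\<lambda>x. u x = u z + Ln (F x / F z)) (at z)"
    using ev1 ev2 ev3
  proof eventually_elim
    case (elim x)
    have "F x / F z = exp (u x - u z)" using elim eF S by (simp add: exp_diff)
    then show ?case using elim by simp
  qed
  \<comment> \<open>At \<open>z\<close> itself the equation holds because
    \<open>Ln 1 = 0\<close>.\<close>
  then have ev: "eventually (\<lambda>x. u x = u z + Ln (F x / F z)) (nhds z)"
    using Fz by (simp add: eventually_nhds_conv_at)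
  have "((\<lambda>x. u z + Ln (F x / F z)) has_field_derivative F' / F z) (at z)"
    using Fz by (auto intro!: derivative_eq_intros F simp: complex_nonpos_Reals_iff)
  then show ?thesis by (subst DERIV_cong_ev[OF refl ev refl])
qed

lemma open_horizontal_slice:
  fixes N :: "('a::topological_space \<times> 'b::topological_space) set"
  assumes "open N" shows "open {z. (z, w) \<in> N}"
proof -
  have "open ((\<lambda>z. (z, w)) -` N)"
    using assms by (intro open_vimage continuous_intros)
  then show ?thesis by (simp add: vimage_def)
qed

lemma open_vertical_slice:
  fixes N :: "('a::topological_space \<times> 'b::topological_space) set"
  assumes "open N" shows "open {w. (z, w) \<in> N}"
proof -
  have "open ((\<lambda>w. (z, w)) -` N)"
    using assms by (intro open_vimage continuous_intros)
  then show ?thesis by (simp add: vimage_def)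
qed

lemma deriv_exp_log_branch:
  fixes g l :: "complex \<Rightarrow> complex"
  assumes "open S" "l holomorphic_on S" "\<And>x. x \<in> S \<Longrightarrow> exp (l x) = g x" "x \<in> S"
  shows "deriv g x = exp (l x) * deriv l x"
proof -
  have "((\<lambda>x. exp (l x)) has_field_derivative exp (l x) * deriv l x) (at x)"
    using assms by (auto intro!: derivative_eq_intros holomorphic_derivI)
  then have "(g has_field_derivative exp (l x) * deriv l x) (at x)"
    using assms by (elim has_field_derivative_transform_within_open) auto
  then show ?thesis by (rule DERIV_imp_deriv)
qed

section \<open>The logarithms \<open>l1\<close> and \<open>l2\<close> as local coordinates\<close>

locale log_coordinates =
  fixes U V :: "complex set" and g1 g2 l1 l2 :: "complex \<Rightarrow> complex"
  assumes U: "open U" and V: "open V"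
    and l1: "l1 holomorphic_on U" and l2: "l2 holomorphic_on V"
    and exp_l1: "z \<in> U \<Longrightarrow> exp (l1 z) = g1 z" and exp_l2: "w \<in> V \<Longrightarrow> exp (l2 w) = g2 w"
    and dg1: "z \<in> U \<Longrightarrow> deriv g1 z \<noteq> 0" and dg2: "w \<in> V \<Longrightarrow> deriv g2 w \<noteq> 0"
begin

lemma deriv_g1: "z \<in> U \<Longrightarrow> deriv g1 z = exp (l1 z) * deriv l1 z"
  using deriv_exp_log_branch[OF U l1 exp_l1] .

lemma deriv_g2: "w \<in> V \<Longrightarrow> deriv g2 w = exp (l2 w) * deriv l2 w"
  using deriv_exp_log_branch[OF V l2 exp_l2] .

lemma dl1: "z \<in> U \<Longrightarrow> deriv l1 z \<noteq> 0" and dl2: "w \<in> V \<Longrightarrow> deriv l2 w \<noteq> 0"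
  using dg1 deriv_g1 dg2 deriv_g2 by fastforce+

definition similarity :: "complex \<times> complex \<Rightarrow> complex" where
  "similarity = (\<lambda>(z, w). l1 z - l2 w)"

text \<open>For fixed \<open>w\<close>, the map is \<open>l1\<close> followed by a translation, and
  \<open>l1\<close> is open near \<open>z\<close> because its derivative does not vanish. Openness
  is what lets functions holomorphic on the image be differentiated at each of its points.\<close>

lemma open_similarity_image:
  assumes N: "open N" "N \<subseteq> U \<times> V"
  shows "open (similarity ` N)"
proof (subst open_subopen, safe)
  fix z w assume zw: "(z, w) \<in> N"
  let ?S = "{z. (z, w) \<in> N}"
  have S: "open ?S" "?S \<subseteq> U" using open_horizontal_slice N by auto
  have "z \<in> ?S" and wV: "w \<in> V" using zw N by auto
  moreover have "l1 holomorphic_on ?S" "deriv l1 z \<noteq> 0"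
    using S \<open>z \<in> ?S\<close> l1 dl1 holomorphic_on_subset by auto
  ultimately obtain r where r: "r > 0" "ball z r \<subseteq> ?S" "open (l1 ` ball z r)"
    using S(1) has_complex_derivative_locally_invertible by metis
  let ?T = "(\<lambda>y. y - l2 w) ` l1 ` ball z r"
  have "open ?T"
    using open_translation[OF r(3), of "- l2 w"] by (simp add: image_image)
  moreover have "?T \<subseteq> similarity ` N"
    using r(2) by (force simp: similarity_def)
  moreover have "similarity (z, w) \<in> ?T"
    using r(1) by (auto simp: similarity_def)
  ultimately show "\<exists>T. open T \<and> similarity (z, w) \<in> T \<and> T \<subseteq> similarity ` N" by blast
qed

lemma deriv_l1: "z \<in> U \<Longrightarrow> (l1 has_field_derivative deriv l1 z) (at z)"
  and deriv_l2: "w \<in> V \<Longrightarrow> (l2 has_field_derivative deriv l2 w) (at w)"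
  and deriv2_l1: "z \<in> U \<Longrightarrow> (deriv l1 has_field_derivative deriv (deriv l1) z) (at z)"
  using holomorphic_derivI[OF l1 U] holomorphic_derivI[OF l2 V]
    holomorphic_derivI[OF holomorphic_deriv[OF l1 U] U] by blast+

text \<open>In terms of the logarithms, \<open>a1\<close> and \<open>a2\<close> enter only through
  \<open>s = a1 * l1 z + a2 * l2 w\<close>: the four prefactors carry \<open>exp (2 * s)\<close>,
  \<open>exp (- s)\<close>, \<open>exp s\<close> and \<open>exp s\<close>. The conditions on the
  domain and on the four functions are bundled in, so that one hypothesis carries
  everything.\<close>

definition ansatz ::
  "complex \<Rightarrow> complex \<Rightarrow> (complex \<times> complex) set \<Rightarrow>
   (complex \<Rightarrow> complex) \<Rightarrow> (complex \<Rightarrow> complex) \<Rightarrow> (complex \<Rightarrow> complex) \<Rightarrow> (complex \<Rightarrow> complex) \<Rightarrow>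
   field2 \<Rightarrow> field2 \<Rightarrow> field2 \<Rightarrow> field2 \<Rightarrow> bool" where
  "ansatz a1 a2 N v h q r u H Q R \<longleftrightarrow>
     open N \<and> N \<subseteq> U \<times> V \<and>
     v holomorphic_on similarity ` N \<and> h holomorphic_on similarity ` N \<and>
     q holomorphic_on similarity ` N \<and> r holomorphic_on similarity ` N \<and>
     (\<forall>x\<in>similarity ` N. v x \<noteq> 0) \<and> continuous_on N (\<lambda>(z, w). u z w) \<and>
     (\<forall>z w. (z, w) \<in> N \<longrightarrow>
        exp (u z w) = exp (2 * (a1 * l1 z + a2 * l2 w)) * deriv l1 z * deriv l2 w * v (l1 z - l2 w) \<and>
        H z w = exp (- (a1 * l1 z + a2 * l2 w)) * h (l1 z - l2 w) \<and>
        Q z w = exp (a1 * l1 z + a2 * l2 w) * (deriv l1 z)\<^sup>2 * q (l1 z - l2 w) \<and>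
        R z w = exp (a1 * l1 z + a2 * l2 w) * (deriv l2 w)\<^sup>2 * r (l1 z - l2 w))"

text \<open>Since \<open>g' = g * l'\<close> for each logarithm, every factor \<open>g'\<close> or
  its square absorbs the shift by 1 or 2 in the corresponding exponent.\<close>

lemma substitution_iff_ansatz:
  "open N \<and> N \<subseteq> U \<times> V \<and>
     v holomorphic_on (\<lambda>(z, w). l1 z - l2 w) ` N \<and> h holomorphic_on (\<lambda>(z, w). l1 z - l2 w) ` N \<and>
     q holomorphic_on (\<lambda>(z, w). l1 z - l2 w) ` N \<and> r holomorphic_on (\<lambda>(z, w). l1 z - l2 w) ` N \<and>
     (\<forall>x\<in>(\<lambda>(z, w). l1 z - l2 w) ` N. v x \<noteq> 0) \<and>
     substitution a1 a2 g1 g2 l1 l2 N v h q r u H Q R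
   \<longleftrightarrow> ansatz a1 a2 N v h q r u H Q R" 
proof -
  have *: "substitution a1 a2 g1 g2 l1 l2 N v h q r u H Q R \<longleftrightarrow>
      continuous_on N (\<lambda>(z, w). u z w) \<and> (\<forall>z w. (z, w) \<in> N \<longrightarrow>
        exp (u z w) = exp (2 * (a1 * l1 z + a2 * l2 w)) * deriv l1 z * deriv l2 w * v (l1 z - l2 w) \<and>
        H z w = exp (- (a1 * l1 z + a2 * l2 w)) * h (l1 z - l2 w) \<and>
        Q z w = exp (a1 * l1 z + a2 * l2 w) * (deriv l1 z)\<^sup>2 * q (l1 z - l2 w) \<and>
        R z w = exp (a1 * l1 z + a2 * l2 w) * (deriv l2 w)\<^sup>2 * r (l1 z - l2 w))"
    if N: "N \<subseteq> U \<times> V"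
  proof -
    have "exp ((2 * a1 - 1) * l1 z) * exp ((2 * a2 - 1) * l2 w) * deriv g1 z * deriv g2 w
          = exp (2 * (a1 * l1 z + a2 * l2 w)) * deriv l1 z * deriv l2 w"
      and "exp (- a1 * l1 z) * exp (- a2 * l2 w) = exp (- (a1 * l1 z + a2 * l2 w))"
      and "exp ((a1 - 2) * l1 z) * exp (a2 * l2 w) * (deriv g1 z)\<^sup>2
          = exp (a1 * l1 z + a2 * l2 w) * (deriv l1 z)\<^sup>2"
      and "exp ((a2 - 2) * l2 w) * exp (a1 * l1 z) * (deriv g2 w)\<^sup>2
          = exp (a1 * l1 z + a2 * l2 w) * (deriv l2 w)\<^sup>2"
      if "(z, w) \<in> N" for z w
    proof -
      have zw: "z \<in> U" "w \<in> V" using that N by auto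
      have e: "exp ((2 * a1 - 1) * l1 z) * exp (l1 z) = exp (2 * a1 * l1 z)"
        "exp ((2 * a2 - 1) * l2 w) * exp (l2 w) = exp (2 * a2 * l2 w)"
        "exp ((a1 - 2) * l1 z) * (exp (l1 z))\<^sup>2 = exp (a1 * l1 z)"
        "exp ((a2 - 2) * l2 w) * (exp (l2 w))\<^sup>2 = exp (a2 * l2 w)"
        by (simp_all add: algebra_simps flip: exp_add exp_double)
      show "exp (- a1 * l1 z) * exp (- a2 * l2 w) = exp (- (a1 * l1 z + a2 * l2 w))"
        by (simp flip: exp_add)
      have "exp ((2 * a1 - 1) * l1 z) * exp ((2 * a2 - 1) * l2 w) * deriv g1 z * deriv g2 w
          = (exp ((2 * a1 - 1) * l1 z) * exp (l1 z)) * (exp ((2 * a2 - 1) * l2 w) * exp (l2 w))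
            * deriv l1 z * deriv l2 w"
        by (simp only: deriv_g1 deriv_g2 zw mult_ac)
      also have "\<dots> = exp (2 * (a1 * l1 z + a2 * l2 w)) * deriv l1 z * deriv l2 w"
        unfolding e by (simp add: distrib_left mult.assoc flip: exp_add)
      finally show "exp ((2 * a1 - 1) * l1 z) * exp ((2 * a2 - 1) * l2 w) * deriv g1 z * deriv g2 w
          = exp (2 * (a1 * l1 z + a2 * l2 w)) * deriv l1 z * deriv l2 w" .
      have "exp ((a1 - 2) * l1 z) * exp (a2 * l2 w) * (deriv g1 z)\<^sup>2
          = (exp ((a1 - 2) * l1 z) * (exp (l1 z))\<^sup>2) * exp (a2 * l2 w) * (deriv l1 z)\<^sup>2"
        by (simp only: deriv_g1 zw power_mult_distrib mult_ac)
      then show "exp ((a1 - 2) * l1 z) * exp (a2 * l2 w) * (deriv g1 z)\<^sup>2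
          = exp (a1 * l1 z + a2 * l2 w) * (deriv l1 z)\<^sup>2"
        unfolding e by (simp only: exp_add)
      have "exp ((a2 - 2) * l2 w) * exp (a1 * l1 z) * (deriv g2 w)\<^sup>2
          = exp (a1 * l1 z) * (exp ((a2 - 2) * l2 w) * (exp (l2 w))\<^sup>2) * (deriv l2 w)\<^sup>2"
        by (simp only: deriv_g2 zw power_mult_distrib mult_ac)
      then show "exp ((a2 - 2) * l2 w) * exp (a1 * l1 z) * (deriv g2 w)\<^sup>2
          = exp (a1 * l1 z + a2 * l2 w) * (deriv l2 w)\<^sup>2"
        unfolding e by (simp only: exp_add)
    qed
    then show ?thesis unfolding substitution_def by auto
  qed
  show ?thesis
  \<comment> \<open>The relation between \<open>g'\<close> and \<open>l'\<close> is available only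
    on \<open>U\<close> and \<open>V\<close>; if \<open>N\<close> leaves
    \<open>U \<times> V\<close>, both sides are false.\<close>
  proof (cases "N \<subseteq> U \<times> V")
    case True
    show ?thesis by (simp only: ansatz_def similarity_def *[OF True])
  qed (simp add: ansatz_def)
qed

lemma equation_reduces_to_iff_ansatz:
  "equation_reduces_to U V a1 a2 g1 g2 l1 l2 L E \<longleftrightarrow>
     (\<exists>lam. (\<forall>z\<in>U. \<forall>w\<in>V. lam z w \<noteq> 0) \<and>
       (\<forall>N v h q r u H Q R z w. ansatz a1 a2 N v h q r u H Q R \<longrightarrow> (z, w) \<in> N \<longrightarrow>
          lam z w * L u H Q R z w = E v h q r (l1 z - l2 w)))"
  unfolding equation_reduces_to_def substitution_iff_ansatz[symmetric]
  by (simp only: imp_conjL Ball_def split_paired_All prod.case all_simps)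

text \<open>The calculations below produce \<open>L\<close> as a nowhere vanishing multiple
  \<open>m\<close> of \<open>E\<close>; the factor asked for is \<open>inverse m\<close>.\<close>

lemma equation_reduces_toI:
  assumes nz: "\<And>z w. z \<in> U \<Longrightarrow> w \<in> V \<Longrightarrow> m z w \<noteq> 0"
    and L: "\<And>N v h q r u H Q R z w. ansatz a1 a2 N v h q r u H Q R \<Longrightarrow> (z, w) \<in> N \<Longrightarrow>
      L u H Q R z w = m z w * E v h q r (l1 z - l2 w)"
  shows "equation_reduces_to U V a1 a2 g1 g2 l1 l2 L E"
  unfolding equation_reduces_to_iff_ansatz
proof (intro exI[of _ "\<lambda>z w. inverse (m z w)"] conjI ballI allI impI)
  fix N v h q r u H Q R z w
  assume "ansatz a1 a2 N v h q r u H Q R" "(z, w) \<in> N"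
  moreover then have "m z w \<noteq> 0" using nz unfolding ansatz_def by blast
  ultimately show "inverse (m z w) * L u H Q R z w = E v h q r (l1 z - l2 w)"
    using L by simp
qed (use nz in auto)

text \<open>Agreement is asked for only where \<open>v\<close> is holomorphic and nonzero, because
  the quotient in \<open>reduced1\<close> can be expanded into derivatives of \<open>v\<close> only
  there. The image of \<open>N\<close> serves as \<open>S\<close>.\<close>

lemma equation_reduces_to_cong:
  assumes red: "equation_reduces_to U V a1 a2 g1 g2 l1 l2 L E"
    and E: "\<And>S v h q r x. open S \<Longrightarrow> x \<in> S \<Longrightarrow> v holomorphic_on S \<Longrightarrow> v x \<noteq> 0 \<Longrightarrow>
      E v h q r x = E' v h q r x"
  shows "equation_reduces_to U V a1 a2 g1 g2 l1 l2 L E'"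
proof -
  have "E v h q r (l1 z - l2 w) = E' v h q r (l1 z - l2 w)"
    if "ansatz a1 a2 N v h q r u H Q R" "(z, w) \<in> N" for N v h q r u H Q R z w
  proof -
    have "l1 z - l2 w \<in> similarity ` N" using that by (force simp: similarity_def)
    then show ?thesis
      using that by (intro E[of "similarity ` N"]) (auto simp: ansatz_def open_similarity_image)
  qed
  with red show ?thesis unfolding equation_reduces_to_iff_ansatz by (elim ex_forward) auto
qed

section \<open>The three equations evaluated on the ansatz\<close>

context
  fixes a1 a2 N v h q r u H Q R
  assumes ansatz: "ansatz a1 a2 N v h q r u H Q R"
begin

lemma ansatz_domain: "open N" "N \<subseteq> U \<times> V"
  and holomorphic_v: "v holomorphic_on similarity ` N" and holomorphic_h: "h holomorphic_on similarity ` N"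
  and holomorphic_q: "q holomorphic_on similarity ` N" and holomorphic_r: "r holomorphic_on similarity ` N"
  and v_nonzero: "x \<in> similarity ` N \<Longrightarrow> v x \<noteq> 0"
  and continuous_u: "continuous_on N (\<lambda>(z, w). u z w)"
  and exp_u_eq: "(z, w) \<in> N \<Longrightarrow>
      exp (u z w) = exp (2 * (a1 * l1 z + a2 * l2 w)) * deriv l1 z * deriv l2 w * v (l1 z - l2 w)"
  and H_eq: "(z, w) \<in> N \<Longrightarrow> H z w = exp (- (a1 * l1 z + a2 * l2 w)) * h (l1 z - l2 w)"
  and Q_eq: "(z, w) \<in> N \<Longrightarrow>
      Q z w = exp (a1 * l1 z + a2 * l2 w) * (deriv l1 z)\<^sup>2 * q (l1 z - l2 w)"
  and R_eq: "(z, w) \<in> N \<Longrightarrow>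
      R z w = exp (a1 * l1 z + a2 * l2 w) * (deriv l2 w)\<^sup>2 * r (l1 z - l2 w)"
  using ansatz unfolding ansatz_def by blast+

lemma similarity_image:
  assumes "(z, w) \<in> N"
  shows "l1 z - l2 w \<in> similarity ` N"
  using assms by (force simp: similarity_def)

lemma open_image: "open (similarity ` N)"
  using ansatz_domain by (rule open_similarity_image)

lemma deriv_along_z:
  assumes "f holomorphic_on similarity ` N" "(z, w) \<in> N"
  shows "((\<lambda>z. f (l1 z - l2 w)) has_field_derivative deriv f (l1 z - l2 w) * deriv l1 z) (at z)"
proof -
  have "(f has_field_derivative deriv f (l1 z - l2 w)) (at (l1 z - l2 w))"
    using assms open_image similarity_image by (intro holomorphic_derivI)
  moreover have "((\<lambda>z. l1 z - l2 w) has_field_derivative deriv l1 z) (at z)"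
    using assms ansatz_domain by (auto intro!: derivative_eq_intros deriv_l1)
  ultimately show ?thesis by (rule DERIV_chain2)
qed

lemma deriv_along_w:
  assumes "f holomorphic_on similarity ` N" "(z, w) \<in> N"
  shows "((\<lambda>w. f (l1 z - l2 w)) has_field_derivative deriv f (l1 z - l2 w) * - deriv l2 w) (at w)"
proof -
  have "(f has_field_derivative deriv f (l1 z - l2 w)) (at (l1 z - l2 w))"
    using assms open_image similarity_image by (intro holomorphic_derivI)
  moreover have "((\<lambda>w. l1 z - l2 w) has_field_derivative - deriv l2 w) (at w)"
    using assms ansatz_domain by (auto intro!: derivative_eq_intros deriv_l2)
  ultimately show ?thesis by (rule DERIV_chain2)
qed

text \<open>The formulas of the ansatz hold only on \<open>N\<close>, but the slice of
  \<open>N\<close> through the point is open, which suffices for computing a derivative.\<close>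

lemma deriv_slice_z:
  assumes "(z, w) \<in> N" "\<And>z. (z, w) \<in> N \<Longrightarrow> f z w = g z w"
    "((\<lambda>z. g z w) has_field_derivative D) (at z)"
  shows "dz f z w = D"
proof -
  have "((\<lambda>z. f z w) has_field_derivative D) (at z)"
    using open_horizontal_slice[OF ansatz_domain(1), of w] assms
    by (intro has_field_derivative_transform_within_open[OF assms(3)]) auto
  then show ?thesis unfolding dz_def by (rule DERIV_imp_deriv)
qed

lemma deriv_slice_w:
  assumes "(z, w) \<in> N" "\<And>w. (z, w) \<in> N \<Longrightarrow> f z w = g z w"
    "((\<lambda>w. g z w) has_field_derivative D) (at w)"
  shows "dzbar f z w = D"
proof -
  have "((\<lambda>w. f z w) has_field_derivative D) (at w)"
    using open_vertical_slice[OF ansatz_domain(1), of z] assms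
    by (intro has_field_derivative_transform_within_open[OF assms(3)]) auto
  then show ?thesis unfolding dzbar_def by (rule DERIV_imp_deriv)
qed

text \<open>This is the logarithmic derivative of the right-hand side prescribed for
  \<open>exp u\<close>. Its first two summands do not depend on \<open>w\<close>, so only the last
  contributes to the mixed derivative.\<close>

lemma dz_u:
  assumes zw: "(z, w) \<in> N"
  shows "dz u z w = 2 * a1 * deriv l1 z + deriv (deriv l1) z / deriv l1 z
    + deriv l1 z * (deriv v (l1 z - l2 w) / v (l1 z - l2 w))"
proof -
  let ?F = "\<lambda>z. exp (2 * (a1 * l1 z + a2 * l2 w)) * deriv l1 z * deriv l2 w * v (l1 z - l2 w)"
  let ?x = "l1 z - l2 w" and ?e = "exp (2 * (a1 * l1 z + a2 * l2 w))"
  let ?D = "?e * (2 * a1 * deriv l1 z) * deriv l1 z * deriv l2 w * v ?x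
      + ?e * deriv (deriv l1) z * deriv l2 w * v ?x
      + ?e * deriv l1 z * deriv l2 w * (deriv v ?x * deriv l1 z)"
  have zU: "z \<in> U" and wV: "w \<in> V" using zw ansatz_domain by auto
  have F: "(?F has_field_derivative ?D) (at z)"
    by (rule derivative_eq_intros deriv_l1[OF zU] deriv2_l1[OF zU] deriv_along_z[OF holomorphic_v zw] refl)+
      (simp add: algebra_simps)
  have "continuous_on {z. (z, w) \<in> N} (\<lambda>z. (\<lambda>(z, w). u z w) (z, w))"
    by (rule continuous_on_compose2[OF continuous_u]) (auto intro!: continuous_intros)
  then have "((\<lambda>z. u z w) has_field_derivative ?D / ?F z) (at z)"
    using zw exp_u_eq by (intro continuous_log_has_field_derivative[OF open_horizontal_slice[OF ansatz_domain(1)] _ _ _ F]) auto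
  moreover have "?D / ?F z = 2 * a1 * deriv l1 z + deriv (deriv l1) z / deriv l1 z
      + deriv l1 z * (deriv v ?x / v ?x)"
    using dl1[OF zU] dl2[OF wV] v_nonzero[OF similarity_image[OF zw]]
    by (simp add: field_simps)
  ultimately show ?thesis unfolding dz_def by (metis DERIV_imp_deriv)
qed

text \<open>The powers of \<open>exp s\<close>, with \<open>s = a1 * l1 z + a2 * l2 w\<close>,
  cancel in the \<open>H\<close>-term and in the \<open>Q R\<close>-term, but in the
  \<open>c\<close>-term nothing compensates \<open>exp (2 * s)\<close>. The formula holds for all
  \<open>a1\<close>, \<open>a2\<close>, \<open>c\<close> and so serves both directions of the
  criterion.\<close>

lemma gauss_lhs_ansatz:
  assumes zw: "(z, w) \<in> N"
  shows "gauss_lhs c u H Q R z w = - (deriv l1 z * deriv l2 w) *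
    (deriv (\<lambda>y. deriv v y / v y) (l1 z - l2 w)
      - 1/2 * ((h (l1 z - l2 w))\<^sup>2 - c\<^sup>2 * exp (2 * (a1 * l1 z + a2 * l2 w))) * v (l1 z - l2 w)
      + 2 * q (l1 z - l2 w) * r (l1 z - l2 w) * inverse (v (l1 z - l2 w)))"
proof -
  let ?x = "l1 z - l2 w" and ?s = "a1 * l1 z + a2 * l2 w"
  \<comment> \<open>Writing all exponentials as powers of one nonzero symbol turns the cancellations
    into field arithmetic.\<close>
  define e where "e = exp ?s"
  have e: "exp ?s = e" "exp (- ?s) = inverse e" "exp (2 * ?s) = e * e" "e \<noteq> 0"
    unfolding e_def by (simp_all only: exp_minus flip: exp_add) simp_all
  have zU: "z \<in> U" and wV: "w \<in> V" using zw ansatz_domain by auto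
  have L: "(\<lambda>y. deriv v y / v y) holomorphic_on similarity ` N"
    using holomorphic_v v_nonzero open_image by (intro holomorphic_intros) auto
  have uzw: "dzbar (dz u) z w = deriv l1 z * (deriv (\<lambda>y. deriv v y / v y) ?x * - deriv l2 w)"
    using DERIV_add[OF DERIV_const DERIV_cmult[OF deriv_along_w[OF L zw]]]
    by (intro deriv_slice_w[OF zw dz_u]) auto
  have nz: "deriv l1 z \<noteq> 0" "deriv l2 w \<noteq> 0" "v ?x \<noteq> 0"
    using dl1 dl2 v_nonzero similarity_image zw zU wV by auto
  have "(H z w)\<^sup>2 * exp (u z w) = deriv l1 z * deriv l2 w * (h ?x)\<^sup>2 * v ?x"
    unfolding exp_u_eq[OF zw] H_eq[OF zw] e using e(4) by (simp add: power2_eq_square field_simps)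
  moreover have "Q z w * R z w * exp (- u z w) = deriv l1 z * deriv l2 w * (q ?x * r ?x / v ?x)"
    unfolding Q_eq[OF zw] R_eq[OF zw] exp_minus[of "u z w"] exp_u_eq[OF zw] e using nz e(4)
    by (simp add: power2_eq_square field_simps)
  ultimately have HQR: "((H z w)\<^sup>2 - c\<^sup>2) * exp (u z w)
      = deriv l1 z * deriv l2 w * ((h ?x)\<^sup>2 - c\<^sup>2 * exp (2 * ?s)) * v ?x"
    "Q z w * R z w * exp (- u z w) = deriv l1 z * deriv l2 w * (q ?x * r ?x * inverse (v ?x))"
    by (simp_all add: exp_u_eq[OF zw] algebra_simps divide_inverse)
  have "gauss_lhs c u H Q R z w = dzbar (dz u) z w + 1/2 * (((H z w)\<^sup>2 - c\<^sup>2) * exp (u z w))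
       - 2 * (Q z w * R z w * exp (- u z w))"
    by (simp add: gauss_lhs_def)
  then show ?thesis unfolding uzw HQR by (simp add: algebra_simps)
qed

text \<open>Both terms share the same prefactor, since \<open>exp (- s)\<close> from
  \<open>H\<close> times \<open>exp (2 * s)\<close> from \<open>exp u\<close> is the
  \<open>exp s\<close> of \<open>Q\<close>. The coefficients \<open>a1\<close> and \<open>a2\<close>
  come from differentiating the prefactors of \<open>H\<close> and \<open>Q\<close>. The overall
  minus sign reflects that \<open>\<xi>\<close> decreases with \<open>l2 w\<close>.\<close>

lemma codazzi_Q_lhs_ansatz:
  assumes zw: "(z, w) \<in> N"
  shows "codazzi_Q_lhs u H Q R z w =
    - 1/2 * (exp (a1 * l1 z + a2 * l2 w) * (deriv l1 z)\<^sup>2 * deriv l2 w) *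
    (2 * deriv q (l1 z - l2 w) + v (l1 z - l2 w) * deriv h (l1 z - l2 w)
      - a1 * v (l1 z - l2 w) * h (l1 z - l2 w) - 2 * a2 * q (l1 z - l2 w))"
proof -
  let ?x = "l1 z - l2 w" and ?s = "a1 * l1 z + a2 * l2 w"
  define e where "e = exp ?s"
  have e: "exp ?s = e" "exp (- ?s) = inverse e" "exp (2 * ?s) = e * e" "e \<noteq> 0"
    unfolding e_def by (simp_all only: exp_minus flip: exp_add) simp_all
  have zU: "z \<in> U" and wV: "w \<in> V" using zw ansatz_domain by auto
  have Qw: "dzbar Q z w =
      exp ?s * (deriv l1 z)\<^sup>2 * deriv l2 w * (a2 * q ?x - deriv q ?x)"
    by (rule deriv_slice_w[OF zw Q_eq], assumption)
      (rule derivative_eq_intros deriv_l2[OF wV] deriv_along_w[OF holomorphic_q zw] refl | simp add: algebra_simps)+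
  have Hz: "dz H z w = exp (- ?s) * deriv l1 z * (deriv h ?x - a1 * h ?x)"
    by (rule deriv_slice_z[OF zw H_eq], assumption)
      (rule derivative_eq_intros deriv_l1[OF zU] deriv_along_z[OF holomorphic_h zw] refl | simp add: algebra_simps)+
  show ?thesis
    unfolding codazzi_Q_lhs_def Qw Hz exp_u_eq[OF zw] e using e(4)
    by (simp add: power2_eq_square field_simps)
qed

lemma codazzi_R_lhs_ansatz:
  assumes zw: "(z, w) \<in> N"
  shows "codazzi_R_lhs u H Q R z w =
    1/2 * (exp (a1 * l1 z + a2 * l2 w) * deriv l1 z * (deriv l2 w)\<^sup>2) *
    (2 * deriv r (l1 z - l2 w) + v (l1 z - l2 w) * deriv h (l1 z - l2 w)
      + a2 * v (l1 z - l2 w) * h (l1 z - l2 w) + 2 * a1 * r (l1 z - l2 w))"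
proof -
  let ?x = "l1 z - l2 w" and ?s = "a1 * l1 z + a2 * l2 w"
  define e where "e = exp ?s"
  have e: "exp ?s = e" "exp (- ?s) = inverse e" "exp (2 * ?s) = e * e" "e \<noteq> 0"
    unfolding e_def by (simp_all only: exp_minus flip: exp_add) simp_all
  have zU: "z \<in> U" and wV: "w \<in> V" using zw ansatz_domain by auto
  have Rz: "dz R z w =
      exp ?s * deriv l1 z * (deriv l2 w)\<^sup>2 * (a1 * r ?x + deriv r ?x)"
    by (rule deriv_slice_z[OF zw R_eq], assumption)
      (rule derivative_eq_intros deriv_l1[OF zU] deriv_along_z[OF holomorphic_r zw] refl | simp add: algebra_simps)+
  have Hw: "dzbar H z w = - (exp (- ?s) * deriv l2 w * (deriv h ?x + a2 * h ?x))"
    by (rule deriv_slice_w[OF zw H_eq], assumption)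
      (rule derivative_eq_intros deriv_l2[OF wV] deriv_along_w[OF holomorphic_h zw] refl | simp add: algebra_simps)+
  show ?thesis
    unfolding codazzi_R_lhs_def Rz Hw exp_u_eq[OF zw] e using e(4)
    by (simp add: power2_eq_square field_simps)
qed

end

section \<open>The criterion for a reduction\<close>

text \<open>Supplies a field \<open>u\<close> with \<open>v = 1\<close> near any point, as needed
  for testing a supposed reduction. On contractible balls the nonvanishing derivatives of
  \<open>l1\<close> and \<open>l2\<close> have holomorphic logarithms \<open>m1\<close> and
  \<open>m2\<close>.\<close>

lemma local_log_exists:
  assumes z: "z \<in> U" and w: "w \<in> V"
  obtains N u where "open N" "N \<subseteq> U \<times> V" "(z, w) \<in> N" "continuous_on N (\<lambda>(z, w). u z w)"
    "\<And>z w. (z, w) \<in> N \<Longrightarrow>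
      exp (u z w) = exp (2 * (a1 * l1 z + a2 * l2 w)) * deriv l1 z * deriv l2 w"
proof -
  obtain d where d: "d > 0" "ball z d \<subseteq> U" using U z openE by blast
  obtain e where e: "e > 0" "ball w e \<subseteq> V" using V w openE by blast
  have "deriv l1 holomorphic_on ball z d" "deriv l2 holomorphic_on ball w e"
    using holomorphic_deriv[OF l1 U] holomorphic_deriv[OF l2 V] d e holomorphic_on_subset by blast+
  moreover have "contractible (ball z d)" "contractible (ball w e)"
    by (simp_all add: convex_imp_contractible)
  moreover have "deriv l1 x \<noteq> 0" if "x \<in> ball z d" for x using that d dl1 by blast
  moreover have "deriv l2 y \<noteq> 0" if "y \<in> ball w e" for y using that e dl2 by blast
  ultimately have "\<exists>m1. m1 holomorphic_on ball z d \<and> (\<forall>x\<in>ball z d. deriv l1 x = exp (m1 x))"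
    "\<exists>m2. m2 holomorphic_on ball w e \<and> (\<forall>y\<in>ball w e. deriv l2 y = exp (m2 y))"
    by (metis contractible_imp_holomorphic_log)+
  then obtain m1 m2
    where m: "m1 holomorphic_on ball z d" "\<And>x. x \<in> ball z d \<Longrightarrow> deriv l1 x = exp (m1 x)"
      "m2 holomorphic_on ball w e" "\<And>y. y \<in> ball w e \<Longrightarrow> deriv l2 y = exp (m2 y)"
    by blast
  let ?u = "\<lambda>x y. 2 * (a1 * l1 x + a2 * l2 y) + m1 x + m2 y"
  let ?N = "ball z d \<times> ball w e"
  have c: "continuous_on (ball z d) l1" "continuous_on (ball w e) l2"
      "continuous_on (ball z d) m1" "continuous_on (ball w e) m2"
    using l1 l2 m d e by (blast intro: holomorphic_on_imp_continuous_on holomorphic_on_subset)+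
  have "continuous_on ?N (\<lambda>p. ?u (fst p) (snd p))"
    by (intro continuous_intros continuous_on_compose2[OF c(1)] continuous_on_compose2[OF c(2)]
        continuous_on_compose2[OF c(3)] continuous_on_compose2[OF c(4)]) auto
  then have "continuous_on ?N (\<lambda>(x, y). ?u x y)" by (simp add: case_prod_beta')
  moreover have "open ?N" "?N \<subseteq> U \<times> V" "(z, w) \<in> ?N" using d e by (auto intro: open_Times)
  moreover have "exp (?u x y) = exp (2 * (a1 * l1 x + a2 * l2 y)) * deriv l1 x * deriv l2 y"
    if "(x, y) \<in> ?N" for x y
    using that m by (simp add: exp_add)
  ultimately show ?thesis by (intro that[of ?N ?u]) blast+
qed

text \<open>
  Adding the same small \<open>t\<close> to both logarithms leaves \<open>\<xi>\<close> unchanged, so the hypothesis says that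
  \<open>exp (2 * (a1 + a2) * t)\<close> is constant in \<open>t\<close>.
\<close>

lemma exponent_sum_zero:
  assumes z0: "z0 \<in> U" and w0: "w0 \<in> V"
    and G: "\<And>z w. z \<in> U \<Longrightarrow> w \<in> V \<Longrightarrow> exp (2 * (a1 * l1 z + a2 * l2 w)) = G (l1 z - l2 w)"
  shows "a1 + a2 = 0"
proof -
  \<comment> \<open>Local openness of \<open>l1\<close> and \<open>l2\<close> makes every small
    common shift of the two logarithms attainable at points of \<open>U\<close> and
    \<open>V\<close>.\<close>
  obtain d where d: "d > 0" "ball z0 d \<subseteq> U" "open (l1 ` ball z0 d)"
    using has_complex_derivative_locally_invertible[OF l1 z0 U dl1[OF z0]] by blast
  obtain e where e: "e > 0" "ball w0 e \<subseteq> V" "open (l2 ` ball w0 e)"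
    using has_complex_derivative_locally_invertible[OF l2 w0 V dl2[OF w0]] by blast
  obtain m where m: "m > 0" "ball (l1 z0) m \<subseteq> l1 ` ball z0 d"
    using openE[OF d(3), of "l1 z0"] d(1) by auto
  obtain k where k: "k > 0" "ball (l2 w0) k \<subseteq> l2 ` ball w0 e"
    using openE[OF e(3), of "l2 w0"] e(1) by auto
  let ?C = "exp (2 * (a1 * l1 z0 + a2 * l2 w0))"
  have const: "exp (2 * (a1 + a2) * t) = 1" if t: "t \<in> ball 0 (min m k)" for t
  proof -
    have "l1 z0 + t \<in> l1 ` ball z0 d" "l2 w0 + t \<in> l2 ` ball w0 e"
      using t m k by (auto simp: dist_norm subset_iff)
    then obtain z w where "z \<in> ball z0 d" "l1 z0 + t = l1 z" "w \<in> ball w0 e" "l2 w0 + t = l2 w"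
      by (elim imageE)
    then have zw: "z \<in> U" "w \<in> V" "l1 z = l1 z0 + t" "l2 w = l2 w0 + t"
      using d(2) e(2) by auto
    have "?C * exp (2 * (a1 + a2) * t) = exp (2 * (a1 * l1 z + a2 * l2 w))"
      unfolding zw exp_add[symmetric] by (simp add: algebra_simps)
    also have "\<dots> = ?C" using G[OF zw(1,2)] G[OF z0 w0] zw by simp
    finally show ?thesis by simp
  qed
  \<comment> \<open>A single value 1 of the exponential fixes its argument only modulo
    \<open>2 * pi * \<i>\<close>; the derivative at 0 removes this ambiguity.\<close>
  have "((\<lambda>t. exp (2 * (a1 + a2) * t)) has_field_derivative 0) (at 0)"
    using m k const
    by (intro has_field_derivative_transform_within_open[OF DERIV_const[of 1], of "ball 0 (min m k)"]) auto
  moreover have "((\<lambda>t. exp (2 * (a1 + a2) * t)) has_field_derivative 2 * (a1 + a2)) (at 0)"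
    by (auto intro!: derivative_eq_intros)
  ultimately have "2 * (a1 + a2) = 0" by (rule DERIV_unique[symmetric])
  then show ?thesis unfolding mult_eq_0_iff by simp
qed

lemma system_reduces:
  assumes asc: "(a1 + a2) * c = 0"
  shows "system_reduces_to U V a1 a2 c g1 g2 l1 l2
    (reduced1 (a1 - a2) c) (reduced2 (a1 + a2) (a1 - a2)) (reduced3 (a1 + a2) (a1 - a2))"
proof -
  \<comment> \<open>If \<open>c\<close> is nonzero, then \<open>a2 = - a1\<close>, and both
    exponents equal \<open>2 * a1 * \<xi>\<close>.\<close>
  have c_exp: "c\<^sup>2 * exp ((a1 - a2) * (l1 z - l2 w)) = c\<^sup>2 * exp (2 * (a1 * l1 z + a2 * l2 w))" for z w
  proof (cases "c = 0")
    case False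
    then have "a2 = - a1" using asc by (simp add: eq_neg_iff_add_eq_0 add.commute)
    then show ?thesis by (simp add: algebra_simps)
  qed simp
  let ?e = "\<lambda>z w. exp (a1 * l1 z + a2 * l2 w)"
  have "equation_reduces_to U V a1 a2 g1 g2 l1 l2 (gauss_lhs c) (reduced1 (a1 - a2) c)"
    by (rule equation_reduces_toI[where m = "\<lambda>z w. - (deriv l1 z * deriv l2 w)"],
        simp add: dl1 dl2, drule (1) gauss_lhs_ansatz[where c = c], simp add: reduced1_def c_exp)
  moreover have "equation_reduces_to U V a1 a2 g1 g2 l1 l2 codazzi_Q_lhs
      (reduced2 (a1 + a2) (a1 - a2))"
    by (rule equation_reduces_toI[where m = "\<lambda>z w. - 1/2 * (?e z w * (deriv l1 z)\<^sup>2 * deriv l2 w)"],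
        simp add: dl1 dl2, drule (1) codazzi_Q_lhs_ansatz, simp add: reduced2_def)
  moreover have "equation_reduces_to U V a1 a2 g1 g2 l1 l2 codazzi_R_lhs
      (reduced3 (a1 + a2) (a1 - a2))"
    by (rule equation_reduces_toI[where m = "\<lambda>z w. 1/2 * (?e z w * deriv l1 z * (deriv l2 w)\<^sup>2)"],
        simp add: dl1 dl2, drule (1) codazzi_R_lhs_ansatz, simp add: reduced3_def)
  ultimately show ?thesis by (simp add: system_reduces_to_def)
qed

text \<open>\<open>reduced1\<close> contains the derivative of a quotient; the quotient rule turns
  it into an expression in the derivatives of \<open>v\<close> up to order 2. The other two
  operators are differential expressions as they stand, and order 2 is taken for all three since
  they share \<open>n\<close>.\<close>

lemma is_reductionI:
  assumes "(a1 + a2) * c = 0"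
  shows "is_reduction U V a1 a2 c g1 g2 l1 l2"
proof -
  have jet: "jet 2 f x ! 0 = f x" "jet 2 f x ! 1 = deriv f x" "jet 2 f x ! 2 = deriv (deriv f) x"
    for f x by (simp_all add: jet_def upt_rec numeral_2_eq_2)
  define F1 where "F1 = (\<lambda>x v h q r. (v!2 * v!0 - (v!1)\<^sup>2) / (v!0)\<^sup>2
      - 1/2 * ((h!0)\<^sup>2 - c\<^sup>2 * exp ((a1 - a2) * x)) * v!0 + 2 * q!0 * r!0 * inverse (v!0))"
  define F2 where "F2 = (\<lambda>(x::complex) v h q (r::complex list). 2 * q!1 + v!0 * h!1 - a1 * v!0 * h!0 - 2 * a2 * q!0)"
  define F3 where "F3 = (\<lambda>(x::complex) v h (q::complex list) r. 2 * r!1 + v!0 * h!1 + a2 * v!0 * h!0 + 2 * a1 * r!0)"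
  note sys = system_reduces[OF assms, unfolded system_reduces_to_def]
  have "equation_reduces_to U V a1 a2 g1 g2 l1 l2 (gauss_lhs c) (differential_expression 2 F1)"
  proof (rule equation_reduces_to_cong)
    fix S and v h q r :: "complex \<Rightarrow> complex" and x
    assume S: "open S" "x \<in> S" and v: "v holomorphic_on S" "v x \<noteq> 0"
    have "((\<lambda>y. deriv v y / v y) has_field_derivative
        (deriv (deriv v) x * v x - deriv v x * deriv v x) / (v x * v x)) (at x)"
      using S v by (intro DERIV_divide holomorphic_derivI[of _ S] holomorphic_deriv) auto
    then have "deriv (\<lambda>y. deriv v y / v y) x = (deriv (deriv v) x * v x - (deriv v x)\<^sup>2) / (v x)\<^sup>2"
      by (simp add: DERIV_imp_deriv power2_eq_square)
    then show "reduced1 (a1 - a2) c v h q r x = differential_expression 2 F1 v h q r x"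
      by (simp only: reduced1_def differential_expression_def F1_def jet)
  qed (use sys in blast)
  moreover have "reduced2 (a1 + a2) (a1 - a2) = differential_expression 2 F2"
    by (intro ext) (simp add: reduced2_def differential_expression_def F2_def jet del: One_nat_def)
  moreover have "reduced3 (a1 + a2) (a1 - a2) = differential_expression 2 F3"
    by (intro ext) (simp add: reduced3_def differential_expression_def F3_def jet del: One_nat_def)
  ultimately have "system_reduces_to U V a1 a2 c g1 g2 l1 l2 (differential_expression 2 F1)
      (differential_expression 2 F2) (differential_expression 2 F3)"
    using sys by (simp add: system_reduces_to_def)
  then show ?thesis unfolding is_reduction_def by blast
qed

text \<open>
  Constant \<open>v = 1\<close>, \<open>h = 0\<close> and \<open>q = r\<close> equal to \<open>0\<close> or \<open>1\<close> already suffice: comparing the two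
  resulting equations first determines the factor as a function of \<open>\<xi>\<close>, and then the term in \<open>c\<^sup>2\<close>.
\<close>

lemma is_reductionD:
  assumes red: "is_reduction U V a1 a2 c g1 g2 l1 l2" and UV: "U \<noteq> {}" "V \<noteq> {}"
  shows "(a1 + a2) * c = 0"
proof (cases "c = 0")
  case False
  obtain n F where
    "equation_reduces_to U V a1 a2 g1 g2 l1 l2 (gauss_lhs c) (differential_expression n F)"
    using red unfolding is_reduction_def system_reduces_to_def by blast
  then obtain lam where lam: "\<And>z w. z \<in> U \<Longrightarrow> w \<in> V \<Longrightarrow> lam z w \<noteq> 0"
    and E: "\<And>N v h q r u H Q R z w. ansatz a1 a2 N v h q r u H Q R \<Longrightarrow> (z, w) \<in> N \<Longrightarrow>
      lam z w * gauss_lhs c u H Q R z w = differential_expression n F v h q r (l1 z - l2 w)"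
    unfolding equation_reduces_to_iff_ansatz by blast
  \<comment> \<open>With constant test functions, \<open>D k\<close> is a function of
    \<open>\<xi>\<close> alone; \<open>P\<close> combines the unknown factor with the explicit one
    from \<open>gauss_lhs_ansatz\<close>.\<close>
  define D where "D k = differential_expression n F (\<lambda>_. 1) (\<lambda>_. 0) (\<lambda>_. k) (\<lambda>_. k)" for k
  define P where "P z w = - lam z w * (deriv l1 z * deriv l2 w)" for z w
  have D: "P z w * (1/2 * c\<^sup>2 * exp (2 * (a1 * l1 z + a2 * l2 w)) + 2 * k\<^sup>2) = D k (l1 z - l2 w)"
    if zw: "z \<in> U" "w \<in> V" for z w k
  proof -
    obtain N u where N: "open N" "N \<subseteq> U \<times> V" "(z, w) \<in> N" and u: "continuous_on N (\<lambda>(z, w). u z w)"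
      "\<And>z w. (z, w) \<in> N \<Longrightarrow>
        exp (u z w) = exp (2 * (a1 * l1 z + a2 * l2 w)) * deriv l1 z * deriv l2 w"
      using local_log_exists[OF zw] by metis
    have A: "ansatz a1 a2 N (\<lambda>_. 1) (\<lambda>_. 0) (\<lambda>_. k) (\<lambda>_. k) u (\<lambda>_ _. 0)
      (\<lambda>z w. exp (a1 * l1 z + a2 * l2 w) * (deriv l1 z)\<^sup>2 * k)
      (\<lambda>z w. exp (a1 * l1 z + a2 * l2 w) * (deriv l2 w)\<^sup>2 * k)"
      using N u unfolding ansatz_def by auto
    show ?thesis
      unfolding D_def E[OF A N(3), symmetric] gauss_lhs_ansatz[OF A N(3)] P_def
      by (simp add: power2_eq_square algebra_simps)
  qed
  \<comment> \<open>The difference of the cases \<open>k = 1\<close> and \<open>k = 0\<close> is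
    \<open>2 * P\<close>. Dividing the case \<open>k = 0\<close> by the resulting \<open>P\<close>
    and by \<open>c\<^sup>2 / 2\<close> isolates the exponential.\<close>
  have "exp (2 * (a1 * l1 z + a2 * l2 w)) =
      (\<lambda>x. D 0 x / ((D 1 x - D 0 x) / 4 * c\<^sup>2)) (l1 z - l2 w)" if "z \<in> U" "w \<in> V" for z w
  proof -
    have "P z w \<noteq> 0" using lam dl1 dl2 that by (simp add: P_def)
    moreover have "D 1 (l1 z - l2 w) - D 0 (l1 z - l2 w) = 2 * P z w"
      and "D 0 (l1 z - l2 w) = P z w * (1/2 * c\<^sup>2 * exp (2 * (a1 * l1 z + a2 * l2 w)))"
      unfolding D[OF that, symmetric] by (simp_all add: algebra_simps)
    ultimately show ?thesis unfolding \<open>D 1 _ - _ = _\<close> \<open>D 0 _ = _\<close> using False by simp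
  qed
  moreover obtain z0 w0 where "z0 \<in> U" "w0 \<in> V" using UV by blast
  ultimately have "a1 + a2 = 0" by (intro exponent_sum_zero)
  then show ?thesis by simp
qed simp

end

section \<open>The first integral of the reduced system\<close>

text \<open>Once the equations have eliminated the derivatives of \<open>v' / v\<close>,
  \<open>q\<close> and \<open>r\<close>, the remaining \<open>v'\<close> and \<open>h'\<close>
  cancel, and what is left carries the factor \<open>c * a_s\<close>.\<close>

lemma first_integral_has_derivative_0:
  assumes W: "open W" "x \<in> W" and sol: "reduced_solution_on W a_s a_d c v h q r"
    and asc: "a_s * c = 0"
  shows "(first_integral a_d c v h q r has_field_derivative 0) (at x)"
proof -
  have hol: "v holomorphic_on W" "h holomorphic_on W" "q holomorphic_on W" "r holomorphic_on W"
    and v0: "\<And>y. y \<in> W \<Longrightarrow> v y \<noteq> 0"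
    using sol by (auto simp: reduced_solution_on_def)
  define L where "L = (\<lambda>y. deriv v y / v y)"
  have Lhol: "L holomorphic_on W" unfolding L_def using hol v0 W by (intro holomorphic_intros) auto
  \<comment> \<open>Naming the values at \<open>x\<close> reduces the claim to a rational identity
    between symbols. \<open>E\<close> has the half exponent because \<open>K\<close> contains both
    \<open>E\<close> and its square.\<close>
  define E v' h' q' r' L' where defs: "E = exp (a_d * x / 2)" "v' = deriv v x" "h' = deriv h x"
    "q' = deriv q x" "r' = deriv r x" "L' = deriv L x"
  have D: "(v has_field_derivative v') (at x)" "(h has_field_derivative h') (at x)"
    "(q has_field_derivative q') (at x)" "(r has_field_derivative r') (at x)"
    "(L has_field_derivative L') (at x)"
    unfolding defs using hol Lhol W by (auto intro!: holomorphic_derivI)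
  have vx: "v x \<noteq> 0" using v0 W by simp
  have Lx: "L x = v' / v x" by (simp add: L_def defs)
  have E2: "exp (a_d / 2 * x) = E" "exp (a_d * x) = E\<^sup>2" unfolding defs by (simp_all flip: exp_double)
  have sys: "reduced1 a_d c v h q r x = 0" "reduced2 a_s a_d v h q r x = 0"
    "reduced3 a_s a_d v h q r x = 0"
    using sol W by (auto simp: reduced_solution_on_def)
  have "L' - 1/2 * ((h x)\<^sup>2 - c\<^sup>2 * E\<^sup>2) * v x + 2 * q x * r x * inverse (v x) = 0"
    "2 * q' + v x * h' - 1/2 * (a_s + a_d) * v x * h x - (a_s - a_d) * q x = 0"
    "2 * r' + v x * h' + 1/2 * (a_s - a_d) * v x * h x + (a_s + a_d) * r x = 0"
    using sys unfolding reduced1_def reduced2_def reduced3_def E2(2) L_def[symmetric] defs(2-)[symmetric] .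
  \<comment> \<open>The system is linear in \<open>L'\<close>, \<open>q'\<close> and
    \<open>r'\<close> and is solved for them, with \<open>h'\<close> left as a free symbol.\<close>
  then have odes: "L' = 1/2 * ((h x)\<^sup>2 - c\<^sup>2 * E\<^sup>2) * v x - 2 * q x * r x * inverse (v x)"
    "q' = (- v x * h' + 1/2 * (a_s + a_d) * v x * h x + (a_s - a_d) * q x) / 2"
    "r' = (- v x * h' - 1/2 * (a_s - a_d) * v x * h x - (a_s + a_d) * r x) / 2"
    by (simp_all add: field_simps) (algebra+)?
  let ?K' = "2 * (v' / v x + a_d) * L'
      - ((2 * h x * h' - c\<^sup>2 * (E\<^sup>2 * a_d)) * v x + ((h x)\<^sup>2 - c\<^sup>2 * E\<^sup>2) * v')
      - 2 * (h' * (q x + r x) + h x * (q' + r'))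
      - 2 * c * (E * (a_d / 2) * (q x - r x) + E * (q' - r'))
      - 4 * ((q' * r x + q x * r') / v x - q x * r x * v' / (v x)\<^sup>2)"
  have K: "first_integral a_d c v h q r = (\<lambda>y. (L y + a_d)\<^sup>2 - ((h y)\<^sup>2 - c\<^sup>2 * exp (a_d * y)) * v y
      - 2 * h y * (q y + r y) - 2 * c * exp (a_d / 2 * y) * (q y - r y) - 4 * (q y * r y / v y))"
    by (simp add: first_integral_def fun_eq_iff L_def)
  have "(first_integral a_d c v h q r has_field_derivative ?K') (at x)"
    unfolding K
    by (rule derivative_eq_intros D vx refl)+
      (simp add: vx E2 Lx field_simps power2_eq_square flip: defs(1))
  moreover have "?K' = - c * a_s * E * (q x + r x + v x * h x)"
    using vx unfolding odes by (simp add: field_simps power2_eq_square)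
  ultimately show ?thesis using asc by auto
qed

theorem mainTheorem2:
  fixes a1 a2 a_s a_d c :: complex
    and U V :: "complex set"
    and g1 g2 l1 l2 :: "complex \<Rightarrow> complex"
  assumes "a_s = a1 + a2" and "a_d = a1 - a2"
    and "open U" and "U \<noteq> {}" and "open V" and "V \<noteq> {}"
    and "g1 holomorphic_on U" and "g2 holomorphic_on V"
    and "\<forall>z\<in>U. g1 z * deriv g1 z \<noteq> 0" and "\<forall>w\<in>V. g2 w * deriv g2 w \<noteq> 0"
    and "l1 holomorphic_on U" and "\<forall>z\<in>U. exp (l1 z) = g1 z"
    and "l2 holomorphic_on V" and "\<forall>w\<in>V. exp (l2 w) = g2 w"
  shows "(is_reduction U V a1 a2 c g1 g2 l1 l2 \<longleftrightarrow> a_s * c = 0) \<and>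
    (a_s * c = 0 \<longrightarrow>
       system_reduces_to U V a1 a2 c g1 g2 l1 l2
         (reduced1 a_d c) (reduced2 a_s a_d) (reduced3 a_s a_d) \<and>
       (\<forall>W v h q r. open W \<longrightarrow> connected W \<longrightarrow> reduced_solution_on W a_s a_d c v h q r \<longrightarrow>
          first_integral a_d c v h q r constant_on W))"
proof -
  interpret log_coordinates U V g1 g2 l1 l2
    using assms by unfold_locales auto
  have "first_integral a_d c v h q r constant_on W"
    if "a_s * c = 0" "open W" "connected W" "reduced_solution_on W a_s a_d c v h q r" for W v h q r
    using that first_integral_has_derivative_0 by (intro has_field_derivative_0_imp_constant_on) blast+
  then show ?thesis
    using is_reductionI[of a1 a2 c] is_reductionD[of a1 a2 c] system_reduces[of a1 a2 c] assms(4,6)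
    unfolding assms(1,2) by (intro conjI iffI impI allI) simp_all
qed

end
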